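(* There exist rooted trees $T_1,T_2$, a largest common minor $T_\mu$ of $T_1$ and $T_2$, and minor embeddings $g_1:T_\mu\to T_1$, $g_2:T_\mu\to T_2$, such that the join $T_{po}$ of $T_1$ and $T_2$ obtained through $g_1$ and $g_2$ contains nodes $v,w\in V(T_{po})$ and two different directed paths from $v$ to $w$ without any common intermediate node, neither of which is the arc $(v,w)$.
   Context: A (rooted) tree is a finite directed graph $T=(V(T),E(T))$, without loops, which is either empty or has a distinguished node $r$ (the root) such that for every other node $v$ there is exactly one directed path from $r$ to $v$. The size of $T$ is the number of its nodes. A tree $S$ is a minor of a tree $T$ if there is an injective map $f:V(S)\to V(T)$ (a minor embedding $f:S\to T$) such that for every arc $(u,v)\in E(S)$ there is a directed path from $f(u)$ to $f(v)$ in $T$ with no intermediate node in $f(V(S))$. A largest common minor of $T_1,T_2$ is a tree that is a minor of both and has the largest size among all such trees. Given $T_1,T_2,T_\mu,g_1,g_2$, let $\theta$ be the equivalence relation on the disjoint union $V(T_1)\sqcup V(T_2)$ defined, up to symmetry, by: $(a,b)\in\theta$ if and only if $a=b$ or there is $c\in V(T_\mu)$ with $a=g_1(c)$ and $b=g_2(c)$. The join $T_{po}$ is the directed graph with node set $(V(T_1)\sqcup V(T_2))/\theta$, in which $([a],[b])$ is an arc if and only if there exist $a'\in[a]$, $b'\in[b]$ and $i\in\{1,2\}$ with $(a',b')\in E(T_i)$. The intermediate nodes of a path $(v_0,v_1,\dots,v_k)$ are $v_1,\dots,v_{k-1}$. *)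

theory Defs
  imports "Graph_Theory.Kuratowski"
begin

(* A directed graph without parallel arcs is a pair_pre_digraph: its arcs are ordered pairs of
   nodes. A path (v_0, ..., v_k) is represented by its list of arcs, and inner_verts returns
   v_1, ..., v_(k-1). *)

(* A tree is finite, loopless and possibly empty. Uniqueness of the path from the root is taken
   over all walks: if only paths without repeated nodes were counted, an arc from a node back to
   one of its ancestors would not be excluded. In a tree in the sense below every walk is a path. *)
definition rooted_tree :: "'a pair_pre_digraph \<Rightarrow> bool" where
  "rooted_tree T \<longleftrightarrow> pair_digraph T \<and>
     (pverts T = {} \<or>
      (\<exists>r\<in>pverts T. \<forall>v\<in>pverts T. v \<noteq> r \<longrightarrow>
         (\<exists>!p. pre_digraph.awalk (with_proj T) r p v)))"

definition minor_embedding ::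
  "('a \<Rightarrow> 'b) \<Rightarrow> 'a pair_pre_digraph \<Rightarrow> 'b pair_pre_digraph \<Rightarrow> bool" where
  "minor_embedding f S T \<longleftrightarrow>
     inj_on f (pverts S) \<and> f ` pverts S \<subseteq> pverts T \<and>
     (\<forall>(u, v)\<in>parcs S. \<exists>p. pre_digraph.apath (with_proj T) (f u) p (f v) \<and>
        set (pre_digraph.inner_verts (with_proj T) p) \<inter> f ` pverts S = {})"

definition minor :: "'a pair_pre_digraph \<Rightarrow> 'b pair_pre_digraph \<Rightarrow> bool" where
  "minor S T \<longleftrightarrow> (\<exists>f. minor_embedding f S T)"

definition common_minor ::
  "'c pair_pre_digraph \<Rightarrow> 'a pair_pre_digraph \<Rightarrow> 'b pair_pre_digraph \<Rightarrow> bool" where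
  "common_minor S T1 T2 \<longleftrightarrow> rooted_tree S \<and> minor S T1 \<and> minor S T2"

(* Nodes of minors are natural numbers: every finite tree is isomorphic to one on naturals, so
   the competitors S cover all common minors up to isomorphism. *)
definition largest_common_minor ::
  "nat pair_pre_digraph \<Rightarrow> 'a pair_pre_digraph \<Rightarrow> 'b pair_pre_digraph \<Rightarrow> bool" where
  "largest_common_minor M T1 T2 \<longleftrightarrow> common_minor M T1 T2 \<and>
     (\<forall>S :: nat pair_pre_digraph. common_minor S T1 T2 \<longrightarrow> card (pverts S) \<le> card (pverts M))"

definition join_rel ::
  "'a pair_pre_digraph \<Rightarrow> 'b pair_pre_digraph \<Rightarrow> 'c pair_pre_digraph \<Rightarrow>
   ('c \<Rightarrow> 'a) \<Rightarrow> ('c \<Rightarrow> 'b) \<Rightarrow> ('a + 'b) rel" where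
  "join_rel T1 T2 M g1 g2 =
     Id_on (pverts T1 <+> pverts T2)
     \<union> {(Inl (g1 c), Inr (g2 c)) | c. c \<in> pverts M}
     \<union> {(Inr (g2 c), Inl (g1 c)) | c. c \<in> pverts M}"

definition tree_join ::
  "'a pair_pre_digraph \<Rightarrow> 'b pair_pre_digraph \<Rightarrow> 'c pair_pre_digraph \<Rightarrow>
   ('c \<Rightarrow> 'a) \<Rightarrow> ('c \<Rightarrow> 'b) \<Rightarrow> ('a + 'b) set pair_pre_digraph" where
  "tree_join T1 T2 M g1 g2 =
     (let N = (pverts T1 <+> pverts T2) // join_rel T1 T2 M g1 g2 in
      \<lparr> pverts = N,
        parcs = {(X, Y). X \<in> N \<and> Y \<in> N \<and>
          ((\<exists>a b. Inl a \<in> X \<and> Inl b \<in> Y \<and> (a, b) \<in> parcs T1) \<or>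
           (\<exists>a b. Inr a \<in> X \<and> Inr b \<in> Y \<and> (a, b) \<in> parcs T2))} \<rparr>)"

end

(* Let T1 be the arc 0 -> 1 with two leaves 2, 3 below 1, and let T2 be the tree with arcs
   0 -> 1 -> 3 and 0 -> 2. Both have four nodes and they are not isomorphic, so a common minor has
   at most three nodes. The tree with root 0 and leaves 2, 3 is therefore a largest one, embedded
   by the identity on both sides. The two copies of node 1 stay distinct in the join, so the join
   has the two paths 0 -> 1 -> 3, one through each copy. *)
theory Submission
  imports Defs
begin

section \<open>Rooted trees and minor embeddings in terms of arc lists\<close>

lemma awalk_with_proj_iff:
  "pre_digraph.awalk (with_proj G) u p v \<longleftrightarrow> u \<in> pverts G \<and> set p \<subseteq> parcs G \<and> pcas u p v"
  by (simp add: pre_digraph.awalk_def cas_with_proj_eq)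

lemma apath_with_proj_iff:
  "pre_digraph.apath (with_proj G) u p v \<longleftrightarrow>
     u \<in> pverts G \<and> set p \<subseteq> parcs G \<and> pcas u p v \<and> distinct (pawalk_verts u p)"
  by (simp add: pre_digraph.apath_def awalk_with_proj_iff awalk_verts_with_proj_eq)

lemma pcas_snoc_iff: "pcas u (p @ [e]) v \<longleftrightarrow> pcas u p (fst e) \<and> snd e = v"
  by (induction p arbitrary: u) auto

text \<open>Reduces uniqueness of walks to a local check on arcs. Since labels increase along arcs,
  going back to predecessors terminates at \<open>r\<close>, which gives a walk; since predecessors
  are unique, two walks to the same node agree arc by arc from the end.\<close>

lemma rooted_treeI:
  fixes T :: "'a::wellorder pair_pre_digraph"
  assumes fin: "finite (pverts T)" and r: "r \<in> pverts T"
    and arcs: "\<And>u v. (u, v) \<in> parcs T \<Longrightarrow> u \<in> pverts T \<and> v \<in> pverts T \<and> u < v \<and> v \<noteq> r"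
    and pred: "\<And>v. v \<in> pverts T \<Longrightarrow> v \<noteq> r \<Longrightarrow> \<exists>!u. (u, v) \<in> parcs T"
  shows "rooted_tree T"
proof -
  have "parcs T \<subseteq> pverts T \<times> pverts T" using arcs by auto
  then have "finite (parcs T)" using fin by (meson finite_SigmaI finite_subset)
  then have "pair_digraph T" using fin arcs by unfold_locales fastforce+
  moreover have ex: "\<exists>p. set p \<subseteq> parcs T \<and> pcas r p v" if "v \<in> pverts T" for v
    using that
  proof (induction v rule: less_induct)
    case (less v)
    show ?case
    proof (cases "v = r")
      case True
      then have "pcas r [] v" by simp
      then show ?thesis by (metis empty_subsetI list.set(1))
    next
      case False
      then obtain u where u: "(u, v) \<in> parcs T" using pred less.prems by blast
      then obtain p where "set p \<subseteq> parcs T" "pcas r p u" using less.IH arcs by blast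
      then have "set (p @ [(u, v)]) \<subseteq> parcs T \<and> pcas r (p @ [(u, v)]) v"
        using u by (simp add: pcas_snoc_iff)
      then show ?thesis by blast
    qed
  qed
  moreover have uniq: "p = q"
    if "set p \<subseteq> parcs T" "pcas r p v" "set q \<subseteq> parcs T" "pcas r q v" for p q v
    using that
  proof (induction p arbitrary: q v rule: rev_induct)
    case Nil
    show ?case
    proof (cases q rule: rev_cases)
      \<comment> \<open>Here \<open>v = r\<close>, so the last arc of a nonempty \<open>q\<close>
        would enter \<open>r\<close>.\<close>
      case (snoc q' e)
      then show ?thesis using Nil arcs by (cases e) (auto simp: pcas_snoc_iff)
    qed simp
  next
    case (snoc e p)
    have e: "(fst e, v) \<in> parcs T" "pcas r p (fst e)" "e = (fst e, v)"
      using snoc.prems by (auto simp: pcas_snoc_iff)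
    show ?case
    proof (cases q rule: rev_cases)
      case Nil
      then show ?thesis using arcs[OF e(1)] snoc.prems(4) by simp
    next
      case (snoc q' e')
      then have e': "(fst e', v) \<in> parcs T" "pcas r q' (fst e')" "e' = (fst e', v)"
        using snoc.prems by (cases e'; auto simp: pcas_snoc_iff)+
      have "fst e = fst e'" using e(1) e'(1) arcs pred by blast
      then show ?thesis using e e' snoc snoc.prems snoc.IH by auto
    qed
  qed
  ultimately have "\<exists>!p. set p \<subseteq> parcs T \<and> pcas r p v" if "v \<in> pverts T" for v
    using that by (metis (no_types, lifting))
  with \<open>pair_digraph T\<close> r show ?thesis
    unfolding rooted_tree_def awalk_with_proj_iff by (intro conjI disjI2 bexI[of _ r]) simp_all
qed

text \<open>The last arc of the walk from the root is the arc wanted.\<close>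

lemma rooted_tree_in_arc:
  assumes "rooted_tree S" "pverts S \<noteq> {}"
  obtains r where "r \<in> pverts S" "\<And>v. v \<in> pverts S \<Longrightarrow> v \<noteq> r \<Longrightarrow> \<exists>u. (u, v) \<in> parcs S"
proof -
  obtain r where r: "r \<in> pverts S"
    "\<And>v. v \<in> pverts S \<Longrightarrow> v \<noteq> r \<Longrightarrow> \<exists>p. set p \<subseteq> parcs S \<and> pcas r p v"
    using assms unfolding rooted_tree_def awalk_with_proj_iff by (metis ex1_implies_ex)
  have "\<exists>u. (u, v) \<in> parcs S" if v: "v \<in> pverts S" "v \<noteq> r" for v
  proof -
    obtain p where p: "set p \<subseteq> parcs S" "pcas r p v" using r(2) v by blast
    show ?thesis
    proof (cases p rule: rev_cases)
      case Nil
      then show ?thesis using p v by simp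
    next
      case (snoc q e)
      then show ?thesis using p by (cases e) (auto simp: pcas_snoc_iff)
    qed
  qed
  with r(1) show ?thesis using that by blast
qed

text \<open>When every node of \<open>T\<close> is an image, no node may be intermediate, so the
  path that replaces an arc is itself a single arc.\<close>

lemma surj_minor_embedding_arc:
  assumes f: "minor_embedding f S T" and surj: "f ` pverts S = pverts T"
    and S: "rooted_tree S" and T: "rooted_tree T" and uv: "(u, v) \<in> parcs S"
  shows "(f u, f v) \<in> parcs T"
proof -
  interpret S: pair_digraph S using S by (simp add: rooted_tree_def)
  interpret T: pair_digraph T using T by (simp add: rooted_tree_def)
  have "u \<noteq> v" "u \<in> pverts S" "v \<in> pverts S"
    using uv S.no_loops' S.in_arcsD1 S.in_arcsD2 by auto
  then have ne: "f u \<noteq> f v" using f by (auto simp: minor_embedding_def inj_on_def)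
  \<comment> \<open>The intermediate nodes of \<open>p\<close> are the tails of all its arcs but the
    first.\<close>
  obtain p where p: "set p \<subseteq> parcs T" "pcas (f u) p (f v)"
    "set (tl (map fst p)) \<inter> pverts T = {}"
    using f uv surj
    by (fastforce simp: minor_embedding_def apath_with_proj_iff inner_verts_with_proj_def)
  show ?thesis
  proof (cases p)
    case Nil
    then show ?thesis using p ne by simp
  next
    case (Cons e es)
    \<comment> \<open>The tail of a second arc would be an intermediate node in
      \<open>pverts T\<close>.\<close>
    then have "es = []" using p T.arc_fst_in_verts by (cases es) auto
    then show ?thesis using p Cons by (cases e) auto
  qed
qed

lemma minor_embedding_idI:
  assumes "rooted_tree S" and verts: "pverts S \<subseteq> pverts T"
    and path: "\<And>u v. (u, v) \<in> parcs S \<Longrightarrow> \<exists>p. set p \<subseteq> parcs T \<and> pcas u p v \<and>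
      distinct (pawalk_verts u p) \<and> set (tl (map fst p)) \<inter> pverts S = {}"
  shows "minor_embedding id S T"
proof -
  interpret S: pair_digraph S using assms(1) by (simp add: rooted_tree_def)
  \<comment> \<open>An \<open>apath\<close> has to start at a node of \<open>T\<close>.\<close>
  have "fst e \<in> pverts T" if "e \<in> parcs S" for e
    using that verts S.arc_fst_in_verts by blast
  then show ?thesis
    using verts path
    by (simp add: minor_embedding_def apath_with_proj_iff inner_verts_with_proj_def split_beta)
qed

section \<open>The two forks and their largest common minor\<close>

definition fork_below :: "nat pair_pre_digraph" where
  "fork_below = \<lparr> pverts = {0, 1, 2, 3}, parcs = {(0, 1), (1, 2), (1, 3)} \<rparr>"

definition fork_above :: "nat pair_pre_digraph" where
  "fork_above = \<lparr> pverts = {0, 1, 2, 3}, parcs = {(0, 1), (0, 2), (1, 3)} \<rparr>"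

text \<open>The label 1 is skipped so that \<open>id\<close> embeds into both forks. As in the
  forks, labels grow along arcs, which suits \<open>rooted_treeI\<close>.\<close>

definition cherry :: "nat pair_pre_digraph" where
  "cherry = \<lparr> pverts = {0, 2, 3}, parcs = {(0, 2), (0, 3)} \<rparr>"

lemma rooted_tree_fork_below: "rooted_tree fork_below"
  by (rule rooted_treeI[of _ 0]) (auto simp: fork_below_def)

lemma rooted_tree_fork_above: "rooted_tree fork_above"
  by (rule rooted_treeI[of _ 0]) (auto simp: fork_above_def)

lemma rooted_tree_cherry: "rooted_tree cherry"
  by (rule rooted_treeI[of _ 0]) (auto simp: cherry_def)

lemma minor_embedding_cherry_fork_below: "minor_embedding id cherry fork_below"
proof (rule minor_embedding_idI[OF rooted_tree_cherry])
  fix u v assume "(u, v) \<in> parcs cherry"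
  then show "\<exists>p. set p \<subseteq> parcs fork_below \<and> pcas u p v \<and> distinct (pawalk_verts u p) \<and>
      set (tl (map fst p)) \<inter> pverts cherry = {}"
    \<comment> \<open>Both arcs of \<open>cherry\<close> are subdivided by 1, which is not a node of
      \<open>cherry\<close>.\<close>
    by (intro exI[of _ "[(0, 1), (1, v)]"]) (auto simp: cherry_def fork_below_def)
qed (simp add: cherry_def fork_below_def)

lemma minor_embedding_cherry_fork_above: "minor_embedding id cherry fork_above"
proof (rule minor_embedding_idI[OF rooted_tree_cherry])
  fix u v assume "(u, v) \<in> parcs cherry"
  then show "\<exists>p. set p \<subseteq> parcs fork_above \<and> pcas u p v \<and> distinct (pawalk_verts u p) \<and>
      set (tl (map fst p)) \<inter> pverts cherry = {}"
    \<comment> \<open>Only the arc to 3 is subdivided here.\<close>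
    by (intro exI[of _ "if v = 2 then [(0, 2)] else [(0, 1), (1, 3)]"])
      (auto simp: cherry_def fork_above_def)
qed (simp add: cherry_def fork_above_def)

text \<open>With four nodes both embeddings would be onto and preserve arcs. Then \<open>S\<close>
  would be a copy of \<open>fork_below\<close>, with two paths of length two from its root, whereas
  \<open>fork_above\<close> has only one path of length two.\<close>

lemma common_minor_forks_card_le:
  fixes S :: "'c pair_pre_digraph"
  assumes "common_minor S fork_below fork_above"
  shows "card (pverts S) \<le> 3"
proof (rule ccontr)
  assume gt: "\<not> card (pverts S) \<le> 3"
  obtain f g where S: "rooted_tree S" and f: "minor_embedding f S fork_below"
    and g: "minor_embedding g S fork_above"
    using assms by (auto simp: common_minor_def minor_def)
  have surj: "h ` pverts S = {0, 1, 2, 3}"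
    if "inj_on h (pverts S)" "h ` pverts S \<subseteq> {0, 1, 2, 3}" for h :: "'c \<Rightarrow> nat"
  proof (rule card_seteq)
    show "card {0::nat, 1, 2, 3} \<le> card (h ` pverts S)"
      using gt that(1) by (simp add: card_image)
  qed (use that in auto)
  have inj: "inj_on f (pverts S)" "inj_on g (pverts S)"
    and sf: "f ` pverts S = {0, 1, 2, 3}" and sg: "g ` pverts S = {0, 1, 2, 3}"
    using f g surj by (auto simp: minor_embedding_def fork_below_def fork_above_def)
  have fa: "(f u, f v) \<in> {(0, 1), (1, 2), (1, 3)}" if "(u, v) \<in> parcs S" for u v
    using surj_minor_embedding_arc[OF f _ S rooted_tree_fork_below that] sf
    by (simp add: fork_below_def)
  have ga: "(g u, g v) \<in> {(0, 1), (0, 2), (1, 3)}" if "(u, v) \<in> parcs S" for u v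
    using surj_minor_embedding_arc[OF g _ S rooted_tree_fork_above that] sg
    by (simp add: fork_above_def)
  \<comment> \<open>The nodes of \<open>S\<close> are named by their images in
    \<open>fork_below\<close>.\<close>
  obtain a b c d where abcd: "a \<in> pverts S" "b \<in> pverts S" "c \<in> pverts S" "d \<in> pverts S"
    and fv: "f a = 0" "f b = 1" "f c = 2" "f d = 3"
  proof -
    have "\<exists>x\<in>pverts S. f x = k" if "k \<in> {0, 1, 2, 3}" for k
      using that unfolding sf[symmetric] by blast
    from this[of 0] this[of 1] this[of 2] this[of 3] show ?thesis using that by auto
  qed
  obtain r where r: "r \<in> pverts S"
    "\<And>v. v \<in> pverts S \<Longrightarrow> v \<noteq> r \<Longrightarrow> \<exists>u. (u, v) \<in> parcs S"
    using rooted_tree_in_arc[OF S] abcd(1) by blast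
  \<comment> \<open>No arc of \<open>fork_below\<close> enters 0, so none of \<open>S\<close> enters
    \<open>a\<close>.\<close>
  have "a = r"
  proof (rule ccontr)
    assume "a \<noteq> r"
    then obtain u where "(u, a) \<in> parcs S" using r abcd by blast
    then show False using fa fv by fastforce
  qed
  interpret S: pair_digraph S using S by (simp add: rooted_tree_def)
  \<comment> \<open>Arcs of \<open>fork_below\<close> lift to \<open>S\<close>: some arc enters
    \<open>v\<close>, and its tail must be \<open>u\<close> because \<open>f u\<close> is the only
    possible predecessor of \<open>f v\<close>.\<close>
  have arc: "(u, v) \<in> parcs S"
    if v: "v \<in> pverts S" "v \<noteq> a" and u: "u \<in> pverts S"
      and pred: "\<And>x. (x, f v) \<in> {(0, 1), (1, 2), (1, 3::nat)} \<Longrightarrow> x = f u" for u v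
  proof -
    obtain x where x: "(x, v) \<in> parcs S" using r(2) v \<open>a = r\<close> by blast
    then have "f x = f u" using fa pred by blast
    then have "x = u" using inj(1) x u S.in_arcsD1 by (meson inj_onD)
    with x show ?thesis by simp
  qed
  have "b \<noteq> a" "c \<noteq> a" "d \<noteq> a" "c \<noteq> d" using fv by auto
  then have "(a, b) \<in> parcs S" "(b, c) \<in> parcs S" "(b, d) \<in> parcs S"
    using abcd by (intro arc; simp add: fv)+
  \<comment> \<open>Since \<open>b\<close> has arcs in and out, \<open>g b = 1\<close>, and the only
    arc leaving 1 in \<open>fork_above\<close> goes to 3.\<close>
  from this[THEN ga] have "g c = g d" by auto
  then show False using inj(2) abcd \<open>c \<noteq> d\<close> by (meson inj_onD)
qed

lemma largest_common_minor_cherry: "largest_common_minor cherry fork_below fork_above"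
  unfolding largest_common_minor_def
proof (intro conjI allI impI)
  show "common_minor cherry fork_below fork_above"
    using rooted_tree_cherry minor_embedding_cherry_fork_below minor_embedding_cherry_fork_above
    by (auto simp: common_minor_def minor_def)
  show "card (pverts S) \<le> card (pverts cherry)" if "common_minor S fork_below fork_above"
    for S :: "nat pair_pre_digraph"
    using common_minor_forks_card_le[OF that] by (simp add: cherry_def)
qed

section \<open>The join of the two forks\<close>

lemma join_forks_nodes:
  "pverts (tree_join fork_below fork_above cherry id id) =
     {{Inl 0, Inr 0}, {Inl 1}, {Inr 1}, {Inl 2, Inr 2}, {Inl 3, Inr 3}}"
proof -
  let ?R = "join_rel fork_below fork_above cherry id id"
  \<comment> \<open>The quotient consists of the images of single nodes, so all eight are
    computed.\<close>
  have "?R `` {Inl 0} = {Inl 0, Inr 0}" "?R `` {Inr 0} = {Inl 0, Inr 0}"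
    "?R `` {Inl 1} = {Inl 1}" "?R `` {Inr 1} = {Inr 1}"
    "?R `` {Inl 2} = {Inl 2, Inr 2}" "?R `` {Inr 2} = {Inl 2, Inr 2}"
    "?R `` {Inl 3} = {Inl 3, Inr 3}" "?R `` {Inr 3} = {Inl 3, Inr 3}"
    by (auto simp: join_rel_def fork_below_def fork_above_def cherry_def)
  moreover have "pverts fork_below <+> pverts fork_above =
      {Inl 0, Inr 0, Inl 1, Inr 1, Inl 2, Inr 2, Inl 3, Inr 3}"
    by (auto simp: fork_below_def fork_above_def)
  ultimately show ?thesis
    by (simp add: tree_join_def Let_def quotient_def insert_commute)
qed

text \<open>Keeps the node set folded, so that \<open>join_forks_nodes\<close> can rewrite
  it.\<close>

lemma join_forks_arcs:
  "(X, Y) \<in> parcs (tree_join fork_below fork_above cherry id id) \<longleftrightarrow>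
     X \<in> pverts (tree_join fork_below fork_above cherry id id) \<and>
     Y \<in> pverts (tree_join fork_below fork_above cherry id id) \<and>
     ((\<exists>a b. Inl a \<in> X \<and> Inl b \<in> Y \<and> (a, b) \<in> parcs fork_below) \<or>
      (\<exists>a b. Inr a \<in> X \<and> Inr b \<in> Y \<and> (a, b) \<in> parcs fork_above))"
  by (simp add: tree_join_def Let_def)

theorem mainTheorem2:
  shows "\<exists>(T1 :: nat pair_pre_digraph) (T2 :: nat pair_pre_digraph) (T\<mu> :: nat pair_pre_digraph)
            (g1 :: nat \<Rightarrow> nat) (g2 :: nat \<Rightarrow> nat).
           rooted_tree T1 \<and> rooted_tree T2 \<and>
           largest_common_minor T\<mu> T1 T2 \<and>
           minor_embedding g1 T\<mu> T1 \<and> minor_embedding g2 T\<mu> T2 \<and>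
           (let Tpo = tree_join T1 T2 T\<mu> g1 g2 in
              \<exists>v\<in>pverts Tpo. \<exists>w\<in>pverts Tpo. \<exists>p q.
                pre_digraph.apath (with_proj Tpo) v p w \<and>
                pre_digraph.apath (with_proj Tpo) v q w \<and>
                p \<noteq> q \<and>
                set (pre_digraph.inner_verts (with_proj Tpo) p) \<inter>
                  set (pre_digraph.inner_verts (with_proj Tpo) q) = {} \<and>
                p \<noteq> [(v, w)] \<and> q \<noteq> [(v, w)])"
proof -
  let ?J = "tree_join fork_below fork_above cherry id id"
  let ?v = "{Inl 0, Inr 0} :: (nat + nat) set" and ?w = "{Inl 3, Inr 3} :: (nat + nat) set"
  \<comment> \<open>The first two arcs come from \<open>fork_below\<close>, the last two from
    \<open>fork_above\<close>.\<close>
  have arcs: "(?v, {Inl 1}) \<in> parcs ?J" "({Inl 1}, ?w) \<in> parcs ?J"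
    "(?v, {Inr 1}) \<in> parcs ?J" "({Inr 1}, ?w) \<in> parcs ?J"
    unfolding join_forks_arcs join_forks_nodes by (simp_all add: fork_below_def fork_above_def)
  have nodes: "?v \<in> pverts ?J" "?w \<in> pverts ?J" by (simp_all add: join_forks_nodes)
  let ?p = "\<lambda>x. [(?v, {x}), ({x}, ?w)]"
  have path: "pre_digraph.apath (with_proj ?J) ?v (?p x) ?w" if "x \<in> {Inl 1, Inr 1}" for x
    using that
  proof (elim insertE emptyE; hypsubst)
  qed (use arcs nodes in \<open>simp_all add: apath_with_proj_iff doubleton_eq_iff\<close>)
  have join: "\<exists>v\<in>pverts ?J. \<exists>w\<in>pverts ?J. \<exists>p q.
      pre_digraph.apath (with_proj ?J) v p w \<and> pre_digraph.apath (with_proj ?J) v q w \<and> p \<noteq> q \<and>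
      set (pre_digraph.inner_verts (with_proj ?J) p) \<inter>
        set (pre_digraph.inner_verts (with_proj ?J) q) = {} \<and>
      p \<noteq> [(v, w)] \<and> q \<noteq> [(v, w)]"
    \<comment> \<open>The only intermediate nodes are \<open>{Inl 1}\<close> and
      \<open>{Inr 1}\<close>, which differ; each path has two arcs, so neither is the arc from
      \<open>?v\<close> to \<open>?w\<close>.\<close>
    by (rule bexI[OF _ nodes(1)], rule bexI[OF _ nodes(2)],
        rule exI[of _ "?p (Inl 1)"], rule exI[of _ "?p (Inr 1)"])
      (simp add: inner_verts_with_proj_def path)
  show ?thesis
    unfolding Let_def
    by (rule exI[of _ fork_below], rule exI[of _ fork_above], rule exI[of _ cherry],
        rule exI[of _ id], rule exI[of _ id])
      (intro conjI rooted_tree_fork_below rooted_tree_fork_above largest_common_minor_cherry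
        minor_embedding_cherry_fork_below minor_embedding_cherry_fork_above join)
qed

end
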